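(* Let $\mathscr{A}$ be an arithmetic variety, and let $\mathcal{G}_{\mathscr{A}}$ be the directed graph with vertex set $\mathscr{A}$ having an edge from $T\in\mathscr{A}$ to $S\in\mathscr{A}\setminus\{\mathbb{N}\}$ if and only if $T=\frac{S}{2}$ (and no other edges). Then $\mathcal{G}_{\mathscr{A}}$ is a directed rooted tree with root $\mathbb{N}$.
   Context: $\mathbb{N}$ denotes the set of non-negative integers. A numerical semigroup is a subset $S\subseteq\mathbb{N}$ containing $0$, closed under addition, with $\mathbb{N}\setminus S$ finite. For a numerical semigroup $S$ and a positive integer $d$, $\frac{S}{d}:=\{x\in\mathbb{N}\mid dx\in S\}$, which is again a numerical semigroup. For numerical semigroups $S,T$, $T$ is an arithmetic extension of $S$ if there exist positive integers $d_1,\dots,d_n$ ($n\ge 1$) such that $T=\{x\in\mathbb{N}\mid \{d_1x,\dots,d_nx\}\subset S\}$. An arithmetic variety is a non-empty family $\mathscr{A}$ of numerical semigroups such that (a) if $S,T\in\mathscr{A}$ then $S\cap T\in\mathscr{A}$; (b) if $S\in\mathscr{A}$ and $T$ is an arithmetic extension of $S$, then $T\in\mathscr{A}$. Every arithmetic variety contains $\mathbb{N}$. A directed rooted tree with root $r$ is a directed graph such that for each vertex $v$ there is a unique directed path from $r$ to $v$ (for $v=r$, the trivial path). *)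

theory Defs
  imports "Graph_Theory.Arc_Walk"
begin

definition numerical_semigroup :: "nat set \<Rightarrow> bool" where
  "numerical_semigroup S \<longleftrightarrow>
     0 \<in> S \<and> (\<forall>x\<in>S. \<forall>y\<in>S. x + y \<in> S) \<and> finite (UNIV - S)"

definition quotient_by :: "nat set \<Rightarrow> nat \<Rightarrow> nat set" where
  "quotient_by S d = {x. d * x \<in> S}"

text \<open>The positive integers $d_1,\dots,d_n$ with $n \ge 1$ are given as a non-empty finite set,
  since neither their order nor their multiplicity matters.\<close>

definition arithmetic_extension :: "nat set \<Rightarrow> nat set \<Rightarrow> bool" where
  "arithmetic_extension T S \<longleftrightarrow>
     numerical_semigroup T \<and> numerical_semigroup S \<and>
     (\<exists>D. finite D \<and> D \<noteq> {} \<and> (\<forall>d\<in>D. 0 < d) \<and> T = {x. (\<lambda>d. d * x) ` D \<subseteq> S})"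

definition arithmetic_variety :: "nat set set \<Rightarrow> bool" where
  "arithmetic_variety A \<longleftrightarrow>
     A \<noteq> {} \<and> (\<forall>S\<in>A. numerical_semigroup S) \<and>
     (\<forall>S\<in>A. \<forall>T\<in>A. S \<inter> T \<in> A) \<and>
     (\<forall>S\<in>A. \<forall>T. arithmetic_extension T S \<longrightarrow> T \<in> A)"

text \<open>Uniqueness is required among all directed walks, the empty walk at the root included.
  Asking for uniqueness only among vertex-simple paths (\<open>apath\<close>) would admit loops and
  arcs back to ancestors; the two lemmas below show that walk uniqueness is the stronger demand.\<close>

definition directed_rooted_tree :: "('a, 'b) pre_digraph \<Rightarrow> 'a \<Rightarrow> bool" where
  "directed_rooted_tree G r \<longleftrightarrow>
     wf_digraph G \<and> r \<in> verts G \<and> (\<forall>v\<in>verts G. \<exists>!p. pre_digraph.awalk G r p v)"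

lemma directed_rooted_tree_unique_apath:
  assumes "directed_rooted_tree G r" and "v \<in> verts G"
  shows "\<exists>!p. pre_digraph.apath G r p v"
proof -
  interpret wf_digraph G using assms(1) by (simp add: directed_rooted_tree_def)
  obtain p where p: "awalk r p v" and u: "\<And>q. awalk r q v \<Longrightarrow> q = p"
    using assms unfolding directed_rooted_tree_def by blast
  have "apath r (awalk_to_apath p) v" using p by (rule apath_awalk_to_apath)
  then show ?thesis using u by (metis apath_def)
qed

lemma directed_rooted_tree_unique_trail:
  assumes "directed_rooted_tree G r" and "v \<in> verts G"
  shows "\<exists>!p. pre_digraph.trail G r p v"
proof -
  interpret wf_digraph G using assms(1) by (simp add: directed_rooted_tree_def)
  obtain p where p: "awalk r p v" and u: "\<And>q. awalk r q v \<Longrightarrow> q = p"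
    using assms unfolding directed_rooted_tree_def by blast
  have "apath r p v" using apath_awalk_to_apath[OF p] u by (metis apath_def)
  then have "distinct p" by (auto simp: apath_def awalk_verts_conv distinct_map split: if_splits)
  then show ?thesis using p u by (metis trail_def)
qed

definition variety_graph :: "nat set set \<Rightarrow> (nat set, nat set \<times> nat set) pre_digraph" where
  "variety_graph A =
     \<lparr> verts = A,
       arcs = {(T, S). T \<in> A \<and> S \<in> A - {UNIV} \<and> T = quotient_by S 2},
       tail = fst,
       head = snd \<rparr>"

end

theory Submission
  imports Defs
begin

text \<open>
  Halving a numerical semigroup \<open>S \<noteq> \<nat>\<close> enlarges it: \<open>S \<subseteq> S/2\<close> because \<open>x \<in> S\<close> gives
  \<open>2x = x + x \<in> S\<close>, and the largest gap \<open>f\<close> of \<open>S\<close> is positive, so \<open>2f > f\<close> lies in \<open>S\<close> and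
  \<open>f\<close> is not a gap of \<open>S/2\<close>. Hence the number of gaps strictly decreases along \<open>S, S/2, S/4, \<dots>\<close>,
  and the sequence ends at \<open>\<nat>\<close>, the only numerical semigroup without gaps. In the graph,
  \<open>S/2\<close> is the unique predecessor of \<open>S \<noteq> \<nat>\<close>, while \<open>\<nat>\<close> has no predecessor; so this sequence,
  read backwards, is the only walk from \<open>\<nat>\<close> to \<open>S\<close>.

  The combinatorial half of the argument is \<open>directed_rooted_treeI_decreasing\<close>, the arithmetic
  half is \<open>card_gaps_quotient_2_less\<close>.
\<close>

text \<open>
  A walk ending in \<open>v \<noteq> r\<close> must end with the only arc into \<open>v\<close>, and what precedes that arc is a
  walk to a vertex of smaller measure, which is unique by induction. A walk from \<open>r\<close> to itself is
  empty because no arc enters \<open>r\<close>.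
\<close>

lemma directed_rooted_treeI_decreasing:
  fixes G :: "('a, 'b) pre_digraph" and m :: "'a \<Rightarrow> nat"
  assumes wf: "wf_digraph G" and root: "r \<in> verts G"
    and no_in: "\<And>e. e \<in> arcs G \<Longrightarrow> head G e \<noteq> r"
    and unique_in: "\<And>v. v \<in> verts G \<Longrightarrow> v \<noteq> r \<Longrightarrow> \<exists>!e. e \<in> arcs G \<and> head G e = v"
    and decreasing: "\<And>e. e \<in> arcs G \<Longrightarrow> m (tail G e) < m (head G e)"
  shows "directed_rooted_tree G r"
proof -
  interpret wf_digraph G by (fact wf)
  have "\<exists>!p. awalk r p v" if "v \<in> verts G" for v
    using that
  proof (induction "m v" arbitrary: v rule: less_induct)
    case less
    show ?case
    proof (cases "v = r")
      case True
      have "p = []" if "awalk r p r" for p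
      proof (cases p rule: rev_cases)
        case (snoc q e)
        then have "e \<in> arcs G \<and> head G e = r"
          using that by (auto simp: awalk_Cons_iff awalk_Nil_iff)
        then show ?thesis using no_in by blast
      qed
      moreover have "awalk r [] r" using root by (simp add: awalk_Nil_iff)
      ultimately show ?thesis using True by blast
    next
      case False
      obtain e where e: "e \<in> arcs G" "head G e = v"
        and e_unique: "\<And>e'. e' \<in> arcs G \<Longrightarrow> head G e' = v \<Longrightarrow> e' = e"
        using unique_in[OF less.prems False] by blast
      have "m (tail G e) < m v" using decreasing[OF e(1)] e(2) by simp
      then have "\<exists>!q. awalk r q (tail G e)"
        using less.hyps tail_in_verts[OF e(1)] by blast
      then obtain q where q: "awalk r q (tail G e)"
        and q_unique: "\<And>q'. awalk r q' (tail G e) \<Longrightarrow> q' = q"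
        by blast
      show ?thesis
      proof (rule ex1I)
        show "awalk r (q @ [e]) v"
          using q e less.prems by (auto simp: awalk_Cons_iff awalk_Nil_iff)
      next
        fix p
        assume p: "awalk r p v"
        show "p = q @ [e]"
        proof (cases p rule: rev_cases)
          case Nil
          then show ?thesis using p False by (simp add: awalk_Nil_iff)
        next
          case (snoc q' e')
          then have "awalk r q' (tail G e')" and e': "e' \<in> arcs G" "head G e' = v"
            using p by (auto simp: awalk_Cons_iff awalk_Nil_iff)
          moreover have "e' = e" using e' by (rule e_unique)
          ultimately have "q' = q" using q_unique by simp
          then show ?thesis using snoc \<open>e' = e\<close> by simp
        qed
      qed
    qed
  qed
  then show ?thesis using wf root by (simp add: directed_rooted_tree_def)
qed

lemma quotient_by_2_superset:
  assumes "numerical_semigroup S"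
  shows "S \<subseteq> quotient_by S 2"
  using assms by (auto simp: numerical_semigroup_def quotient_by_def mult_2)

lemma numerical_semigroup_quotient_2:
  assumes "numerical_semigroup S"
  shows "numerical_semigroup (quotient_by S 2)"
  unfolding numerical_semigroup_def
proof (intro conjI)
  have "UNIV - quotient_by S 2 \<subseteq> UNIV - S"
    using quotient_by_2_superset[OF assms] by blast
  then show "finite (UNIV - quotient_by S 2)"
    using assms finite_subset by (auto simp: numerical_semigroup_def)
qed (use assms in \<open>auto simp: numerical_semigroup_def quotient_by_def add_mult_distrib2\<close>)

text \<open>
  No gap is created since \<open>S \<subseteq> S/2\<close>, and the largest gap is lost: its double is too large to be
  a gap. The assumption \<open>S \<noteq> \<nat>\<close> guarantees that there is a largest gap.
\<close>

lemma card_gaps_quotient_2_less: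
  assumes S: "numerical_semigroup S" and "S \<noteq> UNIV"
  shows "card (UNIV - quotient_by S 2) < card (UNIV - S)"
proof (rule psubset_card_mono)
  show fin: "finite (UNIV - S)" using S by (simp add: numerical_semigroup_def)
  define f where "f = Max (UNIV - S)"
  have "UNIV - S \<noteq> {}" using \<open>S \<noteq> UNIV\<close> by blast
  then have gap: "f \<notin> S" using Max_in[OF fin] by (auto simp: f_def)
  then have "0 < f" using S by (metis gr0I numerical_semigroup_def)
  moreover have "x \<in> S" if "f < x" for x
    using that Max_ge[OF fin, of x] by (force simp: f_def)
  ultimately have "f \<in> quotient_by S 2" by (simp add: quotient_by_def)
  with gap quotient_by_2_superset[OF S]
  show "UNIV - quotient_by S 2 \<subset> UNIV - S" by blast
qed

lemma quotient_2_in_variety: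
  assumes "arithmetic_variety A" and "S \<in> A"
  shows "quotient_by S 2 \<in> A"
proof -
  have S: "numerical_semigroup S" using assms by (simp add: arithmetic_variety_def)
  have "arithmetic_extension (quotient_by S 2) S"
    unfolding arithmetic_extension_def
    by (intro conjI exI[of _ "{2}"] S numerical_semigroup_quotient_2)
       (auto simp: quotient_by_def)
  then show ?thesis using assms by (auto simp: arithmetic_variety_def)
qed

text \<open>
  If \<open>d\<close> exceeds every gap of \<open>S\<close>, then all multiples of \<open>d\<close> lie in \<open>S\<close>, so \<open>S/d = \<nat>\<close>.
\<close>

lemma UNIV_in_variety:
  assumes "arithmetic_variety A"
  shows "UNIV \<in> A"
proof -
  obtain S where "S \<in> A" using assms by (auto simp: arithmetic_variety_def)
  then have S: "numerical_semigroup S" using assms by (simp add: arithmetic_variety_def)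
  then obtain d where d: "\<forall>x\<in>UNIV - S. x < d"
    unfolding numerical_semigroup_def finite_nat_set_iff_bounded by blast
  \<comment> \<open>The divisor is \<open>d + 1\<close> because \<open>d\<close> may be \<open>0\<close>, which happens when \<open>S\<close> has no gaps.\<close>
  have "Suc d * x \<in> S" for x
  proof (cases "x = 0")
    case True
    then show ?thesis using S by (simp add: numerical_semigroup_def)
  next
    case False
    then have "d \<le> Suc d * x" by (cases x) auto
    then show ?thesis using d by (metis DiffI UNIV_I leD)
  qed
  then have "arithmetic_extension UNIV S"
    unfolding arithmetic_extension_def
    using S by (intro conjI exI[of _ "{Suc d}"]) (auto simp: numerical_semigroup_def)
  then show ?thesis using assms \<open>S \<in> A\<close> by (auto simp: arithmetic_variety_def)
qed

theorem theorem22: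
  fixes A :: "nat set set"
  assumes "arithmetic_variety A"
  shows "directed_rooted_tree (variety_graph A) (UNIV :: nat set)"
proof (rule directed_rooted_treeI_decreasing[where m = "\<lambda>S. card (UNIV - S)"])
  show "wf_digraph (variety_graph A)"
    by unfold_locales (auto simp: variety_graph_def)
  show "UNIV \<in> verts (variety_graph A)"
    using UNIV_in_variety[OF assms] by (simp add: variety_graph_def)
  show "head (variety_graph A) e \<noteq> UNIV" if "e \<in> arcs (variety_graph A)" for e
    using that by (auto simp: variety_graph_def)
  show "\<exists>!e. e \<in> arcs (variety_graph A) \<and> head (variety_graph A) e = S"
    if "S \<in> verts (variety_graph A)" "S \<noteq> UNIV" for S
    using that quotient_2_in_variety[OF assms, of S]
    by (intro ex1I[of _ "(quotient_by S 2, S)"]) (auto simp: variety_graph_def)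
  show "card (UNIV - tail (variety_graph A) e) < card (UNIV - head (variety_graph A) e)"
    if "e \<in> arcs (variety_graph A)" for e
    using that assms
    by (auto simp: variety_graph_def arithmetic_variety_def
        intro!: card_gaps_quotient_2_less)
qed

end
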